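(* Let $A\in\mathbb{C}^{m\times n}$ be a standardized matrix (every row has unit $\ell_2$ norm) with full column rank, and let $y=|A\widehat{x}|^2$ (entrywise) for some $\widehat{x}\in\mathbb{C}^n$. For an arbitrary initial estimate $x_0\in\mathbb{C}^n$, the iterates $x_l$ $(l\ge 0)$ produced by the randomized simple Kaczmarz method for phase retrieval, with the row selected uniformly at random in each iteration, satisfy $$\mathbb{E}\bigl[\operatorname{dist}^2(x_l,\widehat{x})\bigr]\le\Bigl(1-\frac{\sigma_{\min}^2(A)}{m}\Bigr)^{l}\operatorname{dist}^2(x_0,\widehat{x})+\frac{4m}{\sigma_{\min}^2(A)}\|y\|_\infty .$$
   Context: The rows of $A$ are denoted $a_r^*$, $r=1,\dots,m$, with $a_r\in\mathbb{C}^n$, and $\langle a_r,x\rangle=a_r^*x$; thus $y_r=|\langle a_r,\widehat{x}\rangle|^2$. $\sigma_{\min}(A)$ is the smallest singular value of $A$. The distance is $\operatorname{dist}(x,\widehat{x})=\min_{\theta\in[0,2\pi)}\|x-\widehat{x}e^{i\theta}\|_2$. The randomized simple Kaczmarz method for phase retrieval: given the (deterministic) $x_0$, at each iteration $l=0,1,2,\dots$ an index $r\in\{1,\dots,m\}$ is drawn uniformly at random, independently of previous draws, and $$x_{l+1}=x_l+\frac{\sqrt{y_r}\,e^{i\theta_l}-\langle a_r,x_l\rangle}{\|a_r\|_2^2}\,a_r,\qquad \theta_l=\angle\langle a_r,x_l\rangle,$$ where $\angle z\in[0,2\pi)$ is the argument of $z\in\mathbb{C}$, with $\angle 0=0$ by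 convention. The expectation is over all the random row selections. *)

theory Defs
  imports "HOL-Analysis.Analysis" "HOL-Probability.Probability"
begin

text \<open>Vectors in complex n-space have type \<^typ>\<open>complex ^ 'n\<close>, whose \<^const>\<open>norm\<close> is the l2 norm.\<close>

definition cinner :: "complex ^ 'n \<Rightarrow> complex ^ 'n \<Rightarrow> complex" where
  "cinner a x = (\<Sum>j\<in>UNIV. cnj (a $ j) * x $ j)"

definition conj_transpose :: "complex ^ 'n ^ 'm \<Rightarrow> complex ^ 'm ^ 'n" where
  "conj_transpose A = map_matrix cnj (transpose A)"

text \<open>The measurement vector \<open>a\<^sub>r\<close> is the conjugate of row \<open>r\<close> of \<open>A\<close> (the row itself is
  the conjugate transpose of \<open>a\<^sub>r\<close>), so that the inner product of \<open>a\<^sub>r\<close> with \<open>x\<close> is entry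
  \<open>r\<close> of \<open>A x\<close>; see \<open>cinner_measurement_vec\<close>.\<close>

definition measurement_vec :: "complex ^ 'n ^ 'm \<Rightarrow> 'm \<Rightarrow> complex ^ 'n" where
  "measurement_vec A r = (\<chi> j. cnj (A $ r $ j))"

lemma cinner_measurement_vec: "cinner (measurement_vec A r) x = (A *v x) $ r"
  by (simp add: cinner_def measurement_vec_def matrix_vector_mult_def)

text \<open>Singular values are the nonnegative square roots of the eigenvalues of the n by n Gram
  matrix of the columns. For at least as many rows as columns these are all the singular
  values; for a wide matrix this set contains the additional value 0.\<close>

definition singular_values :: "complex ^ 'n ^ 'm \<Rightarrow> real set" where
  "singular_values A = {s. 0 \<le> s \<and>
     (\<exists>v. v \<noteq> 0 \<and> (conj_transpose A ** A) *v v = complex_of_real (s\<^sup>2) *s v)}"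

definition sigma_min :: "complex ^ 'n ^ 'm \<Rightarrow> real" where
  "sigma_min A = Min (singular_values A)"

definition phase_dist :: "complex ^ 'n \<Rightarrow> complex ^ 'n \<Rightarrow> real" where
  "phase_dist x z = (INF \<theta>\<in>{0..<2*pi}. norm (x - cis \<theta> *s z))"

text \<open>The infimum is attained, so it is a minimum over the half-open interval.\<close>

lemma phase_dist_attained:
  "\<exists>\<theta>\<in>{0..<2*pi}. phase_dist x z = norm (x - cis \<theta> *s z) \<and>
     (\<forall>\<phi>\<in>{0..<2*pi}. norm (x - cis \<theta> *s z) \<le> norm (x - cis \<phi> *s z))"
proof -
  let ?f = "\<lambda>\<theta>. norm (x - cis \<theta> *s z)"
  have vec: "x - cis \<theta> *s z = (\<chi> i. x $ i - cis \<theta> * z $ i)" for \<theta>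
    by (simp add: vec_eq_iff)
  have "continuous_on {0..2*pi} ?f"
    unfolding vec by (intro continuous_intros)
  moreover have "{0..2*pi} \<noteq> {}" by simp
  ultimately obtain t where t: "t \<in> {0..2*pi}" "\<And>\<phi>. \<phi> \<in> {0..2*pi} \<Longrightarrow> ?f t \<le> ?f \<phi>"
    using continuous_attains_inf[of "{0..2*pi}" ?f] by auto
  define \<theta> where "\<theta> = (if t = 2*pi then 0 else t)"
  have \<theta>: "\<theta> \<in> {0..<2*pi}" using t(1) by (auto simp: \<theta>_def)
  have "?f \<theta> = ?f t" by (simp add: \<theta>_def)
  then have min: "\<forall>\<phi>\<in>{0..<2*pi}. ?f \<theta> \<le> ?f \<phi>" using t(2) by simp
  have "phase_dist x z = ?f \<theta>"
    unfolding phase_dist_def using \<theta> min by (intro cInf_eq_minimum) auto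
  then show ?thesis using \<theta> min by blast
qed

definition kaczmarz_step ::
  "complex ^ 'n ^ 'm \<Rightarrow> real ^ 'm \<Rightarrow> 'm \<Rightarrow> complex ^ 'n \<Rightarrow> complex ^ 'n" where
  "kaczmarz_step A y r x =
     (let a = measurement_vec A r; \<theta> = Arg2pi (cinner a x) in
        x + ((complex_of_real (sqrt (y $ r)) * cis \<theta> - cinner a x)
              / complex_of_real ((norm a)\<^sup>2)) *s a)"

primrec kaczmarz ::
  "complex ^ 'n ^ 'm \<Rightarrow> real ^ 'm \<Rightarrow> complex ^ 'n \<Rightarrow> (nat \<Rightarrow> 'm) \<Rightarrow> nat \<Rightarrow> complex ^ 'n" where
  "kaczmarz A y x\<^sub>0 r 0 = x\<^sub>0"
| "kaczmarz A y x\<^sub>0 r (Suc l) = kaczmarz_step A y (r l) (kaczmarz A y x\<^sub>0 r l)"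

text \<open>The expectation of a function of the iterates is a genuine one: each iterate is a simple
  function of the random row indices.\<close>

lemma simple_function_kaczmarz:
  fixes A :: "complex ^ 'n ^ 'm" and R :: "nat \<Rightarrow> 'w \<Rightarrow> 'm"
  assumes "\<And>l. R l \<in> measurable M (count_space UNIV)"
  shows "simple_function M (\<lambda>\<omega>. kaczmarz A y x\<^sub>0 (\<lambda>k. R k \<omega>) l)"
proof (induction l)
  case (Suc l)
  have "simple_function M (R l)"
    unfolding simple_function_def
    using assms[of l] by (auto intro: measurable_sets)
  with Suc have "simple_function M
      (\<lambda>\<omega>. (\<lambda>r x. kaczmarz_step A y r x) (R l \<omega>) (kaczmarz A y x\<^sub>0 (\<lambda>k. R k \<omega>) l))"
    by (rule simple_function_compose2[rotated])
  then show ?case by simp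
qed simp

end

theory Submission
  imports Defs
begin

text \<open>Fix the best phase for \<open>x\<close>, let \<open>z\<close> be \<open>xhat\<close> rotated by it, and put \<open>h = x - z\<close>. A step replaces the
  component of \<open>h\<close> along the unit vector \<open>a\<^sub>r\<close> by a difference of two complex numbers of modulus
  \<open>sqrt y\<^sub>r\<close>, so the squared distance drops by the squared modulus of \<open>(A h)\<^sub>r\<close> and grows by at most
  \<open>4 y\<^sub>r\<close>. Averaging over \<open>r\<close>, which is independent of \<open>x\<close>, and bounding \<open>A h\<close> below by \<open>sigma_min A\<close>
  gives a contraction with an additive error; its fixed point is the constant in the bound.\<close>

section \<open>Hermitian and real inner products on complex n-space\<close>

lemma inner_vec_complex: "x \<bullet> z = Re (cinner x z)" for x z :: "complex ^ 'n"
  by (simp add: inner_vec_def inner_complex_def cinner_def)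

lemma norm_vec_sq: "(norm x)\<^sup>2 = (\<Sum>j\<in>UNIV. (cmod (x $ j))\<^sup>2)" for x :: "complex ^ 'n"
  by (simp add: norm_vec_def L2_set_def sum_nonneg)

lemma cinner_diff_right: "cinner a (x - z) = cinner a x - cinner a z"
  by (simp add: cinner_def algebra_simps sum_subtractf)

lemma cinner_scaleC_right: "cinner a (c *s x) = c * cinner a x"
  by (simp add: cinner_def algebra_simps sum_distrib_left)

lemma cinner_scaleC_left: "cinner (c *s a) x = cnj c * cinner a x"
  by (simp add: cinner_def algebra_simps sum_distrib_left)

lemma norm_scaleC: "norm (c *s x) = cmod c * norm x" for x :: "complex ^ 'n"
proof -
  have "(norm (c *s x))\<^sup>2 = (cmod c * norm x)\<^sup>2"
    by (simp add: norm_vec_sq norm_mult power_mult_distrib sum_distrib_left)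
  then show ?thesis by (simp add: power2_eq_iff_nonneg)
qed

section \<open>Gram matrix and smallest singular value\<close>

lemma cinner_conj_transpose: "cinner (conj_transpose A *v u) w = cinner u (A *v w)"
proof -
  have "cinner (conj_transpose A *v u) w = (\<Sum>j\<in>UNIV. \<Sum>i\<in>UNIV. A $ i $ j * cnj (u $ i) * w $ j)"
    by (simp add: cinner_def conj_transpose_def transpose_def map_matrix_def
        matrix_vector_mult_def sum_distrib_right)
  also have "\<dots> = (\<Sum>i\<in>UNIV. \<Sum>j\<in>UNIV. A $ i $ j * cnj (u $ i) * w $ j)"
    by (rule sum.swap)
  also have "\<dots> = cinner u (A *v w)"
    by (simp add: cinner_def matrix_vector_mult_def sum_distrib_left mult_ac)
  finally show ?thesis .
qed

text \<open>The right side is symmetric in \<open>u\<close> and \<open>w\<close>, so the Gram matrix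
  is self-adjoint for the real inner product. Complex n-space can thus be treated as a real inner
  product space.\<close>

lemma gram_inner: "((conj_transpose A ** A) *v u) \<bullet> w = (A *v u) \<bullet> (A *v w)"
  for A :: "complex ^ 'n ^ 'm"
  by (simp add: inner_vec_complex cinner_conj_transpose flip: matrix_vector_mul_assoc)

lemma scaleC_of_real: "complex_of_real c *s x = c *\<^sub>R x"
  by (simp add: vec_eq_iff scaleR_conv_of_real[where 'a=complex])

text \<open>Eigenvectors of the Gram matrix for distinct eigenvalues are orthogonal.\<close>

lemma finite_singular_values: "finite (singular_values A)" for A :: "complex ^ 'n ^ 'm"
proof -
  let ?G = "conj_transpose A ** A"
  have "\<exists>v. \<forall>s\<in>singular_values A. v s \<noteq> 0 \<and> ?G *v v s = complex_of_real (s\<^sup>2) *s v s"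
    by (rule bchoice) (auto simp: singular_values_def)
  then obtain v where v: "\<And>s. s \<in> singular_values A \<Longrightarrow> v s \<noteq> 0"
      "\<And>s. s \<in> singular_values A \<Longrightarrow> ?G *v v s = s\<^sup>2 *\<^sub>R v s"
    by (metis scaleC_of_real)
  have orth: "v s \<bullet> v t = 0" if "s \<in> singular_values A" "t \<in> singular_values A" "s \<noteq> t" for s t
  proof -
    have "s\<^sup>2 * (v s \<bullet> v t) = t\<^sup>2 * (v s \<bullet> v t)"
      using gram_inner[of A "v s" "v t"] gram_inner[of A "v t" "v s"] v(2)[OF that(1)] v(2)[OF that(2)]
      by (simp add: inner_commute)
    moreover have "s\<^sup>2 \<noteq> t\<^sup>2"
      using that by (auto simp: singular_values_def power2_eq_iff_nonneg)
    ultimately show ?thesis by simp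
  qed
  \<comment> \<open>Pairwise orthogonal sets are finite in finite dimension. Finiteness passes back
    to the index set because \<open>v\<close> is injective: a nonzero vector is not orthogonal to
    itself.\<close>
  have "pairwise orthogonal (v ` singular_values A)"
    using orth by (auto simp: pairwise_def orthogonal_def)
  then have "finite (v ` singular_values A)" by (rule pairwise_orthogonal_imp_finite)
  moreover have "inj_on v (singular_values A)"
  proof (rule inj_onI)
    fix s t assume st: "s \<in> singular_values A" "t \<in> singular_values A" "v s = v t"
    show "s = t" using orth[OF st(1,2)] st(3) v(1)[OF st(2)] by auto
  qed
  ultimately show ?thesis by (rule finite_imageD)
qed

text \<open>The minimum of the Rayleigh quotient is a critical value, hence an eigenvalue of the Gram
  matrix.\<close>

lemma singular_value_lower_bound:
  fixes A :: "complex ^ 'n ^ 'm"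
  shows "\<exists>s\<in>singular_values A. \<forall>v. s\<^sup>2 * (norm v)\<^sup>2 \<le> (norm (A *v v))\<^sup>2"
proof -
  note lin = matrix_vector_mul_linear[of A]
  let ?S = "sphere (0 :: complex ^ 'n) 1"
  obtain u :: "complex ^ 'n" where "norm u = 1"
    using vector_choose_size[of 1] by auto
  then have "?S \<noteq> {}" by auto
  moreover have "continuous_on ?S (\<lambda>v. norm (A *v v))"
    by (intro continuous_intros)
  ultimately obtain v where v: "norm v = 1" "\<And>w. norm w = 1 \<Longrightarrow> norm (A *v v) \<le> norm (A *v w)"
    using continuous_attains_inf[of ?S "\<lambda>v. norm (A *v v)"] by auto
  define s where "s = norm (A *v v)"
  have bound: "s\<^sup>2 * (norm w)\<^sup>2 \<le> (norm (A *v w))\<^sup>2" for w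
  proof (cases "w = 0")
    case False
    have "s \<le> norm (A *v (w /\<^sub>R norm w))"
      unfolding s_def using False by (intro v(2)) simp
    also have "\<dots> = norm (A *v w) / norm w"
      using linear_scale[OF lin, of "inverse (norm w)" w] by (simp add: field_simps)
    finally have "s * norm w \<le> norm (A *v w)" using False by (simp add: field_simps)
    then show ?thesis using power_mono[of "s * norm w" "norm (A *v w)" 2]
      by (simp add: s_def power_mult_distrib)
  qed simp
  have crit: "(A *v v) \<bullet> (A *v w) = s\<^sup>2 * (v \<bullet> w)" for w
  proof -
    \<comment> \<open>First-order and second-order coefficients in \<open>t\<close> of the squared
      norm of \<open>A *v (v + t *\<^sub>R w)\<close> minus \<open>s\<^sup>2\<close> times that of
      \<open>v + t *\<^sub>R w\<close>. The constant term vanishes because \<open>v\<close> attains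
      the minimum.\<close>
    define b where "b = (A *v v) \<bullet> (A *v w) - s\<^sup>2 * (v \<bullet> w)"
    define c where "c = (norm (A *v w))\<^sup>2 - s\<^sup>2 * (norm w)\<^sup>2"
    have nonneg: "0 \<le> 2 * t * b + t\<^sup>2 * c" for t
    proof -
      have *: "A *v (v + t *\<^sub>R w) = A *v v + t *\<^sub>R (A *v w)"
        using linear_add[OF lin] linear_scale[OF lin] by simp
      have vv: "v \<bullet> v = 1" using v(1) by (simp flip: power2_norm_eq_inner)
      have "s\<^sup>2 = (A *v v) \<bullet> (A *v v)" by (simp add: s_def power2_norm_eq_inner)
      then show ?thesis using bound[of "v + t *\<^sub>R w"] vv
        unfolding b_def c_def power2_norm_eq_inner *
        by (simp add: inner_add_left inner_add_right inner_commute algebra_simps power2_eq_square)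
    qed
    have c0: "0 \<le> c" using bound[of w] by (simp add: c_def)
    have "b = 0"
    proof (rule ccontr)
      assume "b \<noteq> 0"
      \<comment> \<open>At \<open>t = - e\<close> the quadratic equals
        \<open>- (e\<^sup>2 * (c + 2))\<close>, which is negative; the denominator
        \<open>c + 1\<close> also covers \<open>c = 0\<close>.\<close>
      define e where "e = b / (c + 1)"
      have e: "b = e * (c + 1)" using c0 by (simp add: e_def)
      then have "0 < e\<^sup>2 * (c + 2)" using c0 \<open>b \<noteq> 0\<close> by (intro mult_pos_pos) auto
      moreover have "0 \<le> - (e\<^sup>2 * (c + 2))"
        using nonneg[of "- e"] unfolding e by (simp add: algebra_simps power2_eq_square)
      ultimately show False by simp
    qed
    then show ?thesis by (simp add: b_def)
  qed
  have "((conj_transpose A ** A) *v v - s\<^sup>2 *\<^sub>R v) \<bullet> w = 0" for w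
    using crit[of w] by (simp add: inner_diff_left gram_inner)
  then have "(conj_transpose A ** A) *v v = complex_of_real (s\<^sup>2) *s v"
    unfolding scaleC_of_real by (metis inner_eq_zero_iff right_minus_eq)
  moreover have "v \<noteq> 0" using v(1) by auto
  ultimately have "s \<in> singular_values A" by (auto simp: singular_values_def s_def)
  with bound show ?thesis by blast
qed

text \<open>\<open>Min\<close> is meaningful only on a finite nonempty set, which the two preceding
  results supply.\<close>

lemma sigma_min_in: "sigma_min A \<in> singular_values A"
  unfolding sigma_min_def
  using finite_singular_values singular_value_lower_bound by (intro Min_in) auto

lemma sigma_min_bound: "(sigma_min A)\<^sup>2 * (norm v)\<^sup>2 \<le> (norm (A *v v))\<^sup>2"
proof -
  obtain s where s: "s \<in> singular_values A" "\<And>v. s\<^sup>2 * (norm v)\<^sup>2 \<le> (norm (A *v v))\<^sup>2"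
    using singular_value_lower_bound[of A] by auto
  have "0 \<le> sigma_min A" using sigma_min_in[of A] by (simp add: singular_values_def)
  moreover have "sigma_min A \<le> s"
    unfolding sigma_min_def using finite_singular_values s(1) by (rule Min_le)
  ultimately have "(sigma_min A)\<^sup>2 \<le> s\<^sup>2" by (simp add: power_mono)
  then show ?thesis using s(2)[of v] by (meson mult_right_mono order_trans zero_le_power2)
qed

text \<open>A zero eigenvalue of the Gram matrix would put its eigenvector in the kernel of
  \<open>A\<close>, which is trivial at full column rank.\<close>

lemma sigma_min_pos:
  fixes A :: "complex ^ 'n ^ 'm"
  assumes "rank A = CARD('n)"
  shows "0 < sigma_min A"
proof -
  \<comment> \<open>The rank is the dimension of the row span, so the rows span the whole space;
    this is equivalent to left invertibility, hence to injectivity.\<close>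
  have inj: "inj ((*v) A)" using assms 
    unfolding row_rank_def_gen matrix_left_invertible_injective[symmetric]
      matrix_left_invertible_span_rows_gen
    by (simp add: vec.dim_eq_full[symmetric] vec.dimension_def card_cart_basis)
  obtain v where v: "v \<noteq> 0" "(conj_transpose A ** A) *v v = (sigma_min A)\<^sup>2 *\<^sub>R v"
    and nonneg: "0 \<le> sigma_min A"
    using sigma_min_in[of A] unfolding singular_values_def scaleC_of_real by auto
  have "A *v v \<noteq> A *v 0" using inj v(1) by (simp only: inj_eq) simp
  then have "0 < (A *v v) \<bullet> (A *v v)" by simp
  also have "\<dots> = (sigma_min A)\<^sup>2 * (v \<bullet> v)" by (simp add: v(2) flip: gram_inner)
  finally show ?thesis using nonneg by (cases "sigma_min A = 0") auto
qed

section \<open>Upper bounds for unit rows\<close>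

lemma cmod_cinner_le: "cmod (cinner a x) \<le> norm a * norm x"
proof -
  have "cmod (cinner a x) \<le> (\<Sum>j\<in>UNIV. cmod (a $ j) * cmod (x $ j))"
    unfolding cinner_def by (rule order_trans[OF norm_sum]) (simp add: norm_mult)
  also have "\<dots> \<le> norm a * norm x"
    unfolding norm_vec_def using L2_set_mult_ineq[of "\<lambda>j. cmod (a $ j)" "\<lambda>j. cmod (x $ j)" UNIV] by simp
  finally show ?thesis .
qed

lemma norm_measurement_vec: "norm (measurement_vec A r) = norm (A $ r)"
  by (simp add: measurement_vec_def norm_vec_def)

lemma norm_matrix_vec_le:
  fixes A :: "complex ^ 'n ^ 'm"
  assumes "\<And>r. norm (A $ r) = 1"
  shows "(norm (A *v v))\<^sup>2 \<le> real CARD('m) * (norm v)\<^sup>2"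
proof -
  have "(norm (A *v v))\<^sup>2 \<le> (\<Sum>r\<in>(UNIV :: 'm set). (norm v)\<^sup>2)"
    unfolding norm_vec_sq[of "A *v v"]
  proof (rule sum_mono)
    fix r show "(cmod ((A *v v) $ r))\<^sup>2 \<le> (norm v)\<^sup>2"
      using cmod_cinner_le[of "measurement_vec A r" v] assms
      by (intro power_mono) (simp_all add: cinner_measurement_vec norm_measurement_vec)
  qed
  then show ?thesis by simp
qed

text \<open>Makes the contraction factor nonnegative. By Cauchy-Schwarz each of the m entries of
  \<open>A *v v\<close> has modulus at most \<open>norm v\<close>.\<close>

lemma sigma_min_le_card:
  fixes A :: "complex ^ 'n ^ 'm"
  assumes "\<And>r. norm (A $ r) = 1"
  shows "(sigma_min A)\<^sup>2 \<le> real CARD('m)"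
proof -
  obtain v :: "complex ^ 'n" where "norm v = 1" using vector_choose_size[of 1] by auto
  then show ?thesis
    using sigma_min_bound[of A v] norm_matrix_vec_le[OF assms, of v] by simp
qed

section \<open>Error change in one step\<close>

lemma phase_dist_le: "phase_dist x z \<le> norm (x - cis \<theta> *s z)" if "\<theta> \<in> {0..<2*pi}"
  using phase_dist_attained[of x z] that by auto

lemma phase_dist_nonneg: "0 \<le> phase_dist x z"
  using phase_dist_attained[of x z] by auto

text \<open>Pythagoras: moving along the unit vector \<open>a\<close> changes only the component
  along \<open>a\<close>, from \<open>cinner a h\<close> to \<open>c + cinner a h\<close>.\<close>

lemma norm_add_scaleC_unit:
  fixes a h :: "complex ^ 'n"
  assumes "norm a = 1"
  shows "(norm (h + c *s a))\<^sup>2 = (norm h)\<^sup>2 - (cmod (cinner a h))\<^sup>2 + (cmod (c + cinner a h))\<^sup>2"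
proof -
  have "(c *s a) \<bullet> h = Re (cnj c * cinner a h)"
    by (simp add: inner_vec_complex cinner_scaleC_left)
  moreover have "(norm (h + c *s a))\<^sup>2 = (norm h)\<^sup>2 + 2 * ((c *s a) \<bullet> h) + (norm (c *s a))\<^sup>2"
    by (simp add: power2_norm_eq_inner inner_add_left inner_add_right inner_commute)
  ultimately show ?thesis
    using assms by (simp add: norm_scaleC cmod_power2) (simp add: power2_eq_square algebra_simps)
qed

lemma kaczmarz_step_dist:
  fixes A :: "complex ^ 'n ^ 'm"
  assumes "norm (A $ r) = 1" and y: "y $ r = (cmod ((A *v xhat) $ r))\<^sup>2"
    and z: "z = cis \<theta> *s xhat"
  shows "(norm (kaczmarz_step A y r x - z))\<^sup>2
    \<le> (norm (x - z))\<^sup>2 - (cmod ((A *v (x - z)) $ r))\<^sup>2 + 4 * y $ r"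
proof -
  define a where "a = measurement_vec A r"
  define p where "p = cinner a x"
  define q where "q = cinner a z"
  define c where "c = complex_of_real (cmod q) * cis (Arg2pi p) - p"
  have na: "norm a = 1" using assms(1) by (simp add: a_def norm_measurement_vec)
  \<comment> \<open>Measurements are blind to a global phase, so \<open>z\<close> produces the same
    data as \<open>xhat\<close>.\<close>
  have yq: "y $ r = (cmod q)\<^sup>2"
    by (simp add: y q_def z cinner_scaleC_right a_def norm_mult cinner_measurement_vec)
  have "kaczmarz_step A y r x - z = (x - z) + c *s a"
    by (simp add: kaczmarz_step_def Let_def c_def na yq flip: a_def p_def)
  then have "(norm (kaczmarz_step A y r x - z))\<^sup>2
      = (norm (x - z))\<^sup>2 - (cmod (cinner a (x - z)))\<^sup>2 + (cmod (c + cinner a (x - z)))\<^sup>2"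
    using norm_add_scaleC_unit[OF na] by (simp only:)
  moreover have "(cmod (c + cinner a (x - z)))\<^sup>2 \<le> (2 * cmod q)\<^sup>2"
  proof (rule power_mono)
    \<comment> \<open>The term \<open>- p\<close> in \<open>c\<close> cancels
      \<open>cinner a x\<close>, leaving two numbers of modulus \<open>cmod q\<close>, whatever the
      phase of \<open>p\<close>.\<close>
    have "c + cinner a (x - z) = complex_of_real (cmod q) * cis (Arg2pi p) - q"
      by (simp add: c_def cinner_diff_right p_def q_def)
    then show "cmod (c + cinner a (x - z)) \<le> 2 * cmod q"
      using norm_triangle_ineq4[of "complex_of_real (cmod q) * cis (Arg2pi p)" q]
      by (simp add: norm_mult)
  qed simp
  ultimately show ?thesis
    by (simp add: yq power_mult_distrib a_def cinner_measurement_vec)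
qed

lemma kaczmarz_step_mean_dist:
  fixes A :: "complex ^ 'n ^ 'm"
  assumes "\<And>r. norm (A $ r) = 1" and y: "y = (\<chi> r. (cmod ((A *v xhat) $ r))\<^sup>2)"
  shows "(\<Sum>r\<in>UNIV. (phase_dist (kaczmarz_step A y r x) xhat)\<^sup>2) / real CARD('m)
    \<le> (1 - (sigma_min A)\<^sup>2 / real CARD('m)) * (phase_dist x xhat)\<^sup>2 + 4 * infnorm y"
proof -
  let ?m = "real CARD('m)"
  obtain \<theta> where \<theta>: "\<theta> \<in> {0..<2*pi}" "phase_dist x xhat = norm (x - cis \<theta> *s xhat)"
    using phase_dist_attained[of x xhat] by auto
  define z where "z = cis \<theta> *s xhat"
  have "(\<Sum>r\<in>UNIV. (phase_dist (kaczmarz_step A y r x) xhat)\<^sup>2)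
      \<le> (\<Sum>r\<in>UNIV. (norm (x - z))\<^sup>2 - (cmod ((A *v (x - z)) $ r))\<^sup>2 + 4 * infnorm y)"
  proof (rule sum_mono)
    fix r
    \<comment> \<open>The phase optimal for \<open>x\<close> may be suboptimal for the new iterate,
      but still bounds its distance from above.\<close>
    have "(phase_dist (kaczmarz_step A y r x) xhat)\<^sup>2 \<le> (norm (kaczmarz_step A y r x - z))\<^sup>2"
      unfolding z_def using phase_dist_le[OF \<theta>(1)]
      by (intro power_mono) (simp_all add: phase_dist_nonneg)
    also have "\<dots> \<le> (norm (x - z))\<^sup>2 - (cmod ((A *v (x - z)) $ r))\<^sup>2 + 4 * y $ r"
      using assms by (intro kaczmarz_step_dist[where \<theta> = \<theta>]) (simp_all add: z_def)
    also have "y $ r \<le> infnorm y" using component_le_infnorm_cart[of y r] by simp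
    finally show "(phase_dist (kaczmarz_step A y r x) xhat)\<^sup>2
      \<le> (norm (x - z))\<^sup>2 - (cmod ((A *v (x - z)) $ r))\<^sup>2 + 4 * infnorm y" by simp
  qed
  also have "\<dots> = ?m * (norm (x - z))\<^sup>2 - (norm (A *v (x - z)))\<^sup>2 + ?m * (4 * infnorm y)"
    by (simp add: sum.distrib sum_subtractf norm_vec_sq[of "A *v (x - z)"])
  also have "\<dots> \<le> ?m * (norm (x - z))\<^sup>2 - (sigma_min A)\<^sup>2 * (norm (x - z))\<^sup>2 + ?m * (4 * infnorm y)"
    using sigma_min_bound[of A "x - z"] by simp
  finally show ?thesis by (simp add: \<theta>(2) z_def field_simps)
qed

section \<open>Averaging over an independent uniform index\<close>

lemma kaczmarz_cong: "(\<And>k. k < l \<Longrightarrow> r k = s k) \<Longrightarrow> kaczmarz A y x\<^sub>0 r l = kaczmarz A y x\<^sub>0 s l"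
  by (induction l) auto

text \<open>Replaces conditioning on the past: split by the value of \<open>R l\<close>, whose
  indicators are independent of the earlier indices and have mean 1/m. The hypothesis on
  \<open>restrict\<close> says that \<open>g r\<close> reads only those indices.\<close>

lemma (in prob_space) expectation_uniform_indep:
  fixes R :: "nat \<Rightarrow> 'a \<Rightarrow> 'm::finite" and g :: "'m \<Rightarrow> (nat \<Rightarrow> 'm) \<Rightarrow> real"
  assumes indep: "indep_vars (\<lambda>_. count_space UNIV) R UNIV"
    and uniform: "distr M (count_space UNIV) (R l) = uniform_count_measure UNIV"
    and g: "\<And>r f. g r (restrict f {..<l}) = g r f"
    and simple: "\<And>r. simple_function M (\<lambda>\<omega>. g r (\<lambda>k. R k \<omega>))"
  shows "expectation (\<lambda>\<omega>. g (R l \<omega>) (\<lambda>k. R k \<omega>))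
    = expectation (\<lambda>\<omega>. (\<Sum>r\<in>UNIV. g r (\<lambda>k. R k \<omega>)) / real CARD('m))"
proof -
  have R: "R k \<in> measurable M (count_space UNIV)" for k
    using indep by (auto simp: indep_vars_def)
  have simple_ind: "simple_function M (\<lambda>\<omega>. indicator {r} (R l \<omega>) :: real)" for r
  proof -
    have "simple_function M (R l)"
      unfolding simple_function_def using R[of l] by (auto intro: measurable_sets)
    then show ?thesis by (rule simple_function_compose1)
  qed
  have prob: "expectation (\<lambda>\<omega>. indicator {r} (R l \<omega>)) = 1 / real CARD('m)" for r
  proof -
    have "expectation (\<lambda>\<omega>. indicator {r} (R l \<omega>)) = (\<integral>x. indicator {r} x \<partial>distr M (count_space UNIV) (R l) :: real)"
      by (rule integral_distr[OF R, symmetric]) simp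
    also have "\<dots> = 1 / real CARD('m)"
      unfolding uniform by (simp add: measure_uniform_count_measure)
    finally show ?thesis .
  qed
  have int_ind: "integrable M (\<lambda>\<omega>. indicator {r} (R l \<omega>) :: real)" for r
    by (rule integrable_simple_function[OF simple_ind]) simp
  have int: "integrable M (\<lambda>\<omega>. g r (\<lambda>k. R k \<omega>))" for r
    by (rule integrable_simple_function[OF simple]) simp
  have prod: "integrable M (\<lambda>\<omega>. indicator {r} (R l \<omega>) * g r (\<lambda>k. R k \<omega>)) \<and>
      expectation (\<lambda>\<omega>. indicator {r} (R l \<omega>) * g r (\<lambda>k. R k \<omega>))
      = 1 / real CARD('m) * expectation (\<lambda>\<omega>. g r (\<lambda>k. R k \<omega>))" for r
  proof -
    let ?P = "\<lambda>I. PiM I (\<lambda>_. count_space (UNIV :: 'm set))"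
    have "indep_var (?P {l}) (\<lambda>\<omega>. restrict (\<lambda>k. R k \<omega>) {l}) (?P {..<l}) (\<lambda>\<omega>. restrict (\<lambda>k. R k \<omega>) {..<l})"
      by (rule indep_var_restrict[OF indep]) auto
    \<comment> \<open>A finite product of these finite discrete spaces is discrete, so every
      function on it is measurable.\<close>
    then have "indep_var borel ((\<lambda>f. indicator {r} (f l)) \<circ> (\<lambda>\<omega>. restrict (\<lambda>k. R k \<omega>) {l}))
        borel (g r \<circ> (\<lambda>\<omega>. restrict (\<lambda>k. R k \<omega>) {..<l}))"
      by (rule indep_var_compose) (simp_all add: count_space_PiM_finite)
    then have "indep_var borel (\<lambda>\<omega>. indicator {r} (R l \<omega>) :: real) borel (\<lambda>\<omega>. g r (\<lambda>k. R k \<omega>))"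
      by (simp add: comp_def g)
    then show ?thesis
      using indep_var_lebesgue_integral[of "\<lambda>\<omega>. indicator {r} (R l \<omega>) :: real"]
        indep_var_integrable[of "\<lambda>\<omega>. indicator {r} (R l \<omega>) :: real"]
        int_ind int
      by (simp add: prob)
  qed
  have "g (R l \<omega>) (\<lambda>k. R k \<omega>) = (\<Sum>r\<in>UNIV. indicator {r} (R l \<omega>) * g r (\<lambda>k. R k \<omega>))" for \<omega>
    by (simp add: indicator_def if_distrib[of "\<lambda>x. x * _"] cong: if_cong)
  then have "expectation (\<lambda>\<omega>. g (R l \<omega>) (\<lambda>k. R k \<omega>))
      = (\<Sum>r\<in>UNIV. expectation (\<lambda>\<omega>. indicator {r} (R l \<omega>) * g r (\<lambda>k. R k \<omega>)))"
    using prod by (simp only: Bochner_Integration.integral_sum)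
  also have "\<dots> = expectation (\<lambda>\<omega>. (\<Sum>r\<in>UNIV. g r (\<lambda>k. R k \<omega>)) / real CARD('m))"
    using prod int
    by (simp add: Bochner_Integration.integral_sum sum_divide_distrib)
  finally show ?thesis .
qed

section \<open>Recursion for the expected squared distance\<close>

theorem theorem2p4:
  fixes A :: "complex ^ 'n ^ 'm" and xhat x\<^sub>0 :: "complex ^ 'n" and y :: "real ^ 'm"
    and M :: "'w measure" and R :: "nat \<Rightarrow> 'w \<Rightarrow> 'm" and l :: nat
  assumes standardized: "\<And>r. norm (A $ r) = 1"
    and full_column_rank: "rank A = CARD('n)"
    and y: "y = (\<chi> r. (cmod ((A *v xhat) $ r))\<^sup>2)"
    and M: "prob_space M"
    and independent: "prob_space.indep_vars M (\<lambda>_. count_space UNIV) R UNIV"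
    and uniform: "\<And>k. distr M (count_space UNIV) (R k) = uniform_count_measure UNIV"
  shows "prob_space.expectation M (\<lambda>\<omega>. (phase_dist (kaczmarz A y x\<^sub>0 (\<lambda>k. R k \<omega>) l) xhat)\<^sup>2)
       \<le> (1 - (sigma_min A)\<^sup>2 / real CARD('m)) ^ l * (phase_dist x\<^sub>0 xhat)\<^sup>2
         + 4 * real CARD('m) / (sigma_min A)\<^sup>2 * infnorm y"
proof -
  interpret prob_space M by fact
  have R: "R k \<in> measurable M (count_space UNIV)" for k
    using independent by (auto simp: indep_vars_def)
  define q where "q = 1 - (sigma_min A)\<^sup>2 / real CARD('m)"
  define B where "B = 4 * real CARD('m) / (sigma_min A)\<^sup>2 * infnorm y"
  define X where "X l \<omega> = kaczmarz A y x\<^sub>0 (\<lambda>k. R k \<omega>) l" for l \<omega>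
  have X: "simple_function M (X l)" for l
    unfolding X_def using R by (rule simple_function_kaczmarz)
  have int: "integrable M (\<lambda>\<omega>. f (X l \<omega>))" for f :: "complex ^ 'n \<Rightarrow> real" and l
    by (rule integrable_simple_function[OF simple_function_compose1[OF X, of f l]]) simp
  have q: "0 \<le> q"
    using sigma_min_le_card[OF standardized] by (simp add: q_def divide_le_eq)
  \<comment> \<open>Positivity of \<open>sigma_min A\<close> permits the division in
    \<open>B\<close>; the fixed-point equation lets the induction absorb each new error without
    accumulation.\<close>
  have B: "q * B + 4 * infnorm y = B" and B0: "0 \<le> B"
    using sigma_min_pos[OF full_column_rank] infnorm_pos_le[of y]
    by (simp_all add: q_def B_def field_simps)
  have "expectation (\<lambda>\<omega>. (phase_dist (X l \<omega>) xhat)\<^sup>2) \<le> q ^ l * (phase_dist x\<^sub>0 xhat)\<^sup>2 + B"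
  proof (induction l)
    case 0
    then show ?case using B0 by (simp add: X_def prob_space)
  next
    case (Suc l)
    let ?g = "\<lambda>r f. (phase_dist (kaczmarz_step A y r (kaczmarz A y x\<^sub>0 f l)) xhat)\<^sup>2"
    have "expectation (\<lambda>\<omega>. (phase_dist (X (Suc l) \<omega>) xhat)\<^sup>2)
        = expectation (\<lambda>\<omega>. ?g (R l \<omega>) (\<lambda>k. R k \<omega>))"
      by (simp add: X_def)
    also have "\<dots> = expectation (\<lambda>\<omega>. (\<Sum>r\<in>UNIV. ?g r (\<lambda>k. R k \<omega>)) / real CARD('m))"
    proof (rule expectation_uniform_indep[OF independent uniform])
      \<comment> \<open>Iterate \<open>l\<close> has used only the indices below \<open>l\<close>,
        so the draw \<open>R l\<close> is independent of it.\<close>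
      show "?g r (restrict f {..<l}) = ?g r f" for r f
        using kaczmarz_cong[of l "restrict f {..<l}" f A y x\<^sub>0] by simp
      show "simple_function M (\<lambda>\<omega>. ?g r (\<lambda>k. R k \<omega>))" for r
        using simple_function_compose1[OF X, of "\<lambda>x. (phase_dist (kaczmarz_step A y r x) xhat)\<^sup>2" l]
        by (simp add: X_def)
    qed
    also have "\<dots> \<le> expectation (\<lambda>\<omega>. q * (phase_dist (X l \<omega>) xhat)\<^sup>2 + 4 * infnorm y)"
    proof (rule integral_mono)
      show "integrable M (\<lambda>\<omega>. (\<Sum>r\<in>UNIV. ?g r (\<lambda>k. R k \<omega>)) / real CARD('m))"
        using int[of "\<lambda>x. (\<Sum>r\<in>UNIV. (phase_dist (kaczmarz_step A y r x) xhat)\<^sup>2) / real CARD('m)" l]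
        by (simp add: X_def)
      show "integrable M (\<lambda>\<omega>. q * (phase_dist (X l \<omega>) xhat)\<^sup>2 + 4 * infnorm y)"
        by (rule int)
      show "(\<Sum>r\<in>UNIV. ?g r (\<lambda>k. R k \<omega>)) / real CARD('m)
          \<le> q * (phase_dist (X l \<omega>) xhat)\<^sup>2 + 4 * infnorm y" for \<omega>
        unfolding X_def q_def by (rule kaczmarz_step_mean_dist[OF standardized y])
    qed
    also have "\<dots> = q * expectation (\<lambda>\<omega>. (phase_dist (X l \<omega>) xhat)\<^sup>2) + 4 * infnorm y"
      using int[of "\<lambda>x. (phase_dist x xhat)\<^sup>2" l] by (simp add: prob_space)
    also have "\<dots> \<le> q * (q ^ l * (phase_dist x\<^sub>0 xhat)\<^sup>2 + B) + 4 * infnorm y"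
      using mult_left_mono[OF Suc.IH q] by simp
    also have "\<dots> = q ^ Suc l * (phase_dist x\<^sub>0 xhat)\<^sup>2 + B"
      using B by (simp add: algebra_simps)
    finally show ?case .
  qed
  then show ?thesis by (simp add: X_def q_def B_def)
qed

end
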